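(* Let $n \ge 2$ be an integer, and consider an $n \times n$ board which is initially empty. Each minute, one of the following three moves may be performed: (1) If there is an L-shaped tromino region of three cells without stones on the board, that is, cells $(i,j)$, $(i+1,j)$, $(i,j+1)$ with $1 \le i,j \le n-1$ (rotations not allowed), one may place a stone in each of those three cells. (2) If all cells in a column have a stone, one may remove all stones from that column. (3) If all cells in a row have a stone, one may remove all stones from that row. Then it is possible that, after some nonzero number of moves, the board has no stones if and only if $n$ is divisible by $3$.
   Context: The cell $(i,j)$, for $1 \le i,j \le n$, is the cell in the $i$-th column (counting from the left) and the $j$-th row (counting from the bottom). Each cell contains either zero or one stone. *)

theory Defs
  imports Main
begin

text \<open>The pair \<open>(i, j)\<close> is the cell in the \<open>i\<close>-th column from the left and the
  \<open>j\<close>-th row from the bottom. A position is the set of cells that contain a stone.\<close>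

type_synonym cell = "nat \<times> nat"

definition column :: "nat \<Rightarrow> nat \<Rightarrow> cell set" where
  "column n i = {(i, j) | j. 1 \<le> j \<and> j \<le> n}"

definition row :: "nat \<Rightarrow> nat \<Rightarrow> cell set" where
  "row n j = {(i, j) | i. 1 \<le> i \<and> i \<le> n}"

definition tromino :: "nat \<Rightarrow> nat \<Rightarrow> cell set" where
  "tromino i j = {(i, j), (i + 1, j), (i, j + 1)}"

inductive move :: "nat \<Rightarrow> cell set \<Rightarrow> cell set \<Rightarrow> bool" for n :: nat where
  place: "move n S (S \<union> tromino i j)"
    if "1 \<le> i" "i \<le> n - 1" "1 \<le> j" "j \<le> n - 1" "tromino i j \<inter> S = {}"
| clear_column: "move n S (S - column n i)"
    if "1 \<le> i" "i \<le> n" "column n i \<subseteq> S"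
| clear_row: "move n S (S - row n j)"
    if "1 \<le> j" "j \<le> n" "row n j \<subseteq> S"

end

(* Necessity: give the cell (i, j) the weight x^(i-1) y^(j-1) and restrict to the line
   1 + x + y = 0, on which trominoes weigh nothing.  Write G(x) = 1 + x + ... + x^(n-1).  If the
   i-th column is cleared c_i times, the j-th row r_j times, and the board ends up empty, then
   C(x) G(y) + R(y) G(x) = 0 on that line, where C and R have coefficients c_i and r_j.
   If 3 does not divide n, then G(x) and G(-1-x) have no common zero, so C vanishes at all zeros
   of G and is a constant multiple of G; so is R, and the two constants cancel.
   Since they are nonnegative, nothing was ever removed.

   Sufficiency: clear all 3 x 3 blocks simultaneously, by placing trominoes at the corners (1, 1)
   and (2, 2) of every block, clearing the middle column of all blocks, placing trominoes
   at (2, 1), and clearing the lower two rows of all blocks. *)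

theory Submission
  imports Defs Complex_Main
begin

section \<open>Necessity\<close>

definition weight :: "complex \<Rightarrow> complex \<Rightarrow> cell set \<Rightarrow> complex" where
  "weight x y S = (\<Sum>(i, j)\<in>S. x ^ (i - 1) * y ^ (j - 1))"

abbreviation geom :: "nat \<Rightarrow> complex \<Rightarrow> complex" where
  "geom n x \<equiv> (\<Sum>i<n. x ^ i)"

lemma column_eq_image: "column n i = (\<lambda>j. (i, Suc j)) ` {..<n}"
proof -
  have "{j. 1 \<le> j \<and> j \<le> n} = Suc ` {..<n}"
    by (auto simp: lessThan_atLeast0 image_Suc_atLeastLessThan)
  moreover have "column n i = Pair i ` {j. 1 \<le> j \<and> j \<le> n}"
    by (auto simp: column_def)
  ultimately show ?thesis by (simp add: image_image)
qed

lemma row_eq_image: "row n j = (\<lambda>i. (Suc i, j)) ` {..<n}"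
proof -
  have "{j. 1 \<le> j \<and> j \<le> n} = Suc ` {..<n}"
    by (auto simp: lessThan_atLeast0 image_Suc_atLeastLessThan)
  moreover have "row n j = (\<lambda>i. (i, j)) ` {j. 1 \<le> j \<and> j \<le> n}"
    by (auto simp: row_def)
  ultimately show ?thesis by (simp add: image_image)
qed

lemma weight_column: "weight x y (column n (Suc i)) = x ^ i * geom n y"
  unfolding weight_def column_eq_image
  by (subst sum.reindex) (auto simp: inj_on_def sum_distrib_left)

lemma weight_row: "weight x y (row n (Suc j)) = y ^ j * geom n x"
  unfolding weight_def row_eq_image
  by (subst sum.reindex) (auto simp: inj_on_def sum_distrib_left mult.commute)

lemma weight_tromino:
  assumes "1 + x + y = 0" "1 \<le> i" "1 \<le> j"
  shows "weight x y (tromino i j) = 0"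
proof -
  obtain a b where "i = Suc a" "j = Suc b"
    using assms by (metis Suc_le_D One_nat_def)
  then have "weight x y (tromino i j) = x ^ a * y ^ b * (1 + x + y)"
    by (simp add: weight_def tromino_def algebra_simps)
  then show ?thesis using assms by simp
qed

lemma weight_Un:
  "finite S \<Longrightarrow> finite T \<Longrightarrow> S \<inter> T = {} \<Longrightarrow> weight x y (S \<union> T) = weight x y S + weight x y T"
  unfolding weight_def by (rule sum.union_disjoint)

lemma weight_Diff:
  "finite S \<Longrightarrow> T \<subseteq> S \<Longrightarrow> weight x y (S - T) = weight x y S - weight x y T"
  unfolding weight_def by (rule sum_diff)

lemma sum_increment:
  assumes "a < n"
  shows "(\<Sum>i<n. of_nat ((c(a := Suc (c a))) i) * x ^ i :: complex)
    = (\<Sum>i<n. of_nat (c i) * x ^ i) + x ^ a"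
proof -
  have "(\<Sum>i<n. of_nat ((c(a := Suc (c a))) i) * x ^ i :: complex)
    = (\<Sum>i<n. of_nat (c i) * x ^ i + (if i = a then x ^ a else 0))"
    by (rule sum.cong) (auto simp: algebra_simps)
  then show ?thesis using assms by (simp add: sum.distrib)
qed

text \<open>A placement adds no weight when 1 + x + y = 0, and a clearing moves its term from the
  weight into one of the two sums: \<open>c i\<close> counts clearings of column
  \<open>Suc i\<close>, \<open>r i\<close> those of row \<open>Suc i\<close>. The first conjunct on
  \<open>c\<close> and \<open>r\<close> holds because a placement leaves stones behind, so an empty
  board with k > 0 was produced by a clearing.\<close>

lemma moves_weight:
  assumes "(move n ^^ k) {} S"
  shows "finite S \<and> (\<exists>c r :: nat \<Rightarrow> nat. (S = {} \<longrightarrow> k = 0 \<or> (\<exists>i<n. c i > 0 \<or> r i > 0)) \<and>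
    (\<forall>x y. 1 + x + y = 0 \<longrightarrow> weight x y S + (\<Sum>i<n. of_nat (c i) * x ^ i) * geom n y
      + (\<Sum>i<n. of_nat (r i) * y ^ i) * geom n x = 0))"
  using assms
proof (induction k arbitrary: S)
  case 0
  then show ?case by (auto simp: weight_def intro!: exI[of _ "\<lambda>_. 0 :: nat"])
next
  case (Suc k)
  then obtain T where T: "(move n ^^ k) {} T" "move n T S"
    by (auto elim: relpowp_Suc_E)
  from Suc.IH[OF T(1)] obtain c r where fin: "finite T"
    and eq: "\<And>x y. 1 + x + y = 0 \<Longrightarrow> weight x y T + (\<Sum>i<n. of_nat (c i) * x ^ i) * geom n y
      + (\<Sum>i<n. of_nat (r i) * y ^ i) * geom n x = 0"
    by blast
  from T(2) show ?case
  proof cases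
    case (place i j)
    have "finite (tromino i j)" "T \<inter> tromino i j = {}"
      using place by (auto simp: tromino_def)
    then have "weight x y S = weight x y T" if "1 + x + y = 0" for x y
      using weight_Un[OF fin] weight_tromino[OF that] place by simp
    then have "\<forall>x y. 1 + x + y = 0 \<longrightarrow> weight x y S + (\<Sum>i<n. of_nat (c i) * x ^ i) * geom n y
      + (\<Sum>i<n. of_nat (r i) * y ^ i) * geom n x = 0"
      using eq by simp
    moreover have "S \<noteq> {}" "finite S"
      using place fin by (auto simp: tromino_def)
    ultimately show ?thesis by blast
  next
    case (clear_column i)
    then obtain a where a: "i = Suc a" "a < n"
      by (metis Suc_le_D One_nat_def Suc_le_lessD)
    let ?c = "c(a := Suc (c a))"
    have *: "weight x y S = weight x y T - x ^ a * geom n y" for x y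
      using weight_Diff[OF fin] clear_column a by (simp add: weight_column)
    then have "\<forall>x y. 1 + x + y = 0 \<longrightarrow> weight x y S + (\<Sum>i<n. of_nat (?c i) * x ^ i) * geom n y
      + (\<Sum>i<n. of_nat (r i) * y ^ i) * geom n x = 0"
      unfolding sum_increment[OF a(2)] * ring_distribs using eq unfolding add.assoc by simp
    moreover have "\<exists>i<n. ?c i > 0" "finite S"
      using a fin clear_column by auto
    ultimately show ?thesis by blast
  next
    case (clear_row j)
    then obtain a where a: "j = Suc a" "a < n"
      by (metis Suc_le_D One_nat_def Suc_le_lessD)
    let ?r = "r(a := Suc (r a))"
    have *: "weight x y S = weight x y T - y ^ a * geom n x" for x y
      using weight_Diff[OF fin] clear_row a by (simp add: weight_row)
    then have "\<forall>x y. 1 + x + y = 0 \<longrightarrow> weight x y S + (\<Sum>i<n. of_nat (c i) * x ^ i) * geom n y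
      + (\<Sum>i<n. of_nat (?r i) * y ^ i) * geom n x = 0"
      unfolding sum_increment[OF a(2)] * ring_distribs using eq unfolding add.assoc by simp
    moreover have "\<exists>i<n. ?r i > 0" "finite S"
      using a fin clear_row by auto
    ultimately show ?thesis by blast
  qed
qed

section \<open>Zeros of \<open>geom\<close> and roots of unity\<close>

lemma geom_eq_0_iff:
  assumes "n > 0"
  shows "geom n x = 0 \<longleftrightarrow> x \<noteq> 1 \<and> x ^ n = 1"
  using assms by (cases "x = 1") (auto simp: geometric_sum)

text \<open>Two numbers of modulus 1 with sum -1 are the primitive cube roots of unity, and these
  are n-th roots of unity only if 3 divides n.\<close>

lemma geom_no_common_zero:
  assumes "\<not> 3 dvd n" "1 + x + y = 0" "geom n x = 0" "geom n y = 0"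
  shows False
proof -
  have n: "n > 0" using assms(1) by (cases n) auto
  have x: "x \<noteq> 1" "x ^ n = 1" and y: "y ^ n = 1"
    using assms geom_eq_0_iff[OF n] by auto
  have "norm x = 1" "norm y = 1"
    using power_eq_1_iff[OF x(2)] power_eq_1_iff[OF y] n by auto
  then have "x * cnj x = 1" "y * cnj y = 1"
    by (simp_all flip: complex_norm_square)
  moreover have "y = - 1 - x" using assms(2) by (simp add: algebra_simps eq_neg_iff_add_eq_0)
  \<comment> \<open>Expanding |-1 - x|^2 = 1 with |x| = 1 gives the second equation; multiplied by x
    it becomes the quadratic below.\<close>
  ultimately have *: "x * cnj x = 1" "x + cnj x = - 1"
    by (simp_all add: algebra_simps eq_neg_iff_add_eq_0)
  then have quad: "x ^ 2 + x + 1 = 0"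
    by algebra
  then have cube: "x ^ 3 = 1"
    by algebra
  have "x ^ n = x ^ (3 * (n div 3) + n mod 3)" by simp
  also have "\<dots> = x ^ (n mod 3)" by (simp only: power_add power_mult cube power_one mult_1)
  finally have "x ^ (n mod 3) = 1" using x by simp
  moreover have "n mod 3 = 1 \<or> n mod 3 = 2" using assms(1) by presburger
  ultimately have "x = 1 \<or> x ^ 2 = 1" by auto
  \<comment> \<open>Putting x^2 = 1 into the quadratic forces x = -2, whose square is 4.\<close>
  with quad x(1) have "x ^ 2 = 1" "x = - 2"
    by (auto simp: eq_neg_iff_add_eq_0 algebra_simps)
  then show False by simp
qed

text \<open>Subtracting \<open>c (n - 1)\<close> times \<open>geom n\<close> removes the top term.
  The remainder has degree at most n - 2 but vanishes at the n - 1 nontrivial n-th roots of unity,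
  so all its coefficients are 0.\<close>

lemma eq_const_if_zero_at_roots_of_unity:
  fixes c :: "nat \<Rightarrow> complex"
  assumes n: "n \<ge> 2" and zero: "\<And>x. geom n x = 0 \<Longrightarrow> (\<Sum>i<n. c i * x ^ i) = 0"
    and i: "i < n"
  shows "c i = c (n - 1)"
proof (rule ccontr)
  assume neq: "c i \<noteq> c (n - 1)"
  define d where "d i = c i - c (n - 1)" for i
  let ?Z = "{x. (\<Sum>i\<le>n - 2. d i * x ^ i) = 0}"
  have "d i \<noteq> 0" using neq by (simp add: d_def)
  moreover have "i \<le> n - 2" using i neq by (cases "i = n - 1") auto
  ultimately have fin: "finite ?Z" and card: "card ?Z \<le> n - 2"
    using polyfun_rootbound[of d i "n - 2"] by auto
  have "{..<n} = insert (n - 1) {..n - 2}" using n by auto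
  then have d: "(\<Sum>i<n. d i * x ^ i) = (\<Sum>i\<le>n - 2. d i * x ^ i)" for x
    using n by (simp add: d_def)
  have "(\<Sum>i<n. d i * x ^ i) = (\<Sum>i<n. c i * x ^ i) - c (n - 1) * geom n x" for x
    by (simp add: d_def left_diff_distrib sum_subtractf sum_distrib_left)
  with zero have "(\<Sum>i<n. d i * x ^ i) = 0" if "geom n x = 0" for x
    using that by simp
  with d have "{x. geom n x = 0} \<subseteq> ?Z" by auto
  moreover have "{x. geom n x = 0} = {x. x ^ n = 1} - {1}"
    using geom_eq_0_iff n by auto
  moreover have "card ({x::complex. x ^ n = 1} - {1}) = n - 1"
    using n by (simp add: card_roots_unity_eq)
  ultimately have "n - 1 \<le> card ?Z"
    using card_mono[OF fin, of "{x. geom n x = 0}"] by (simp only:)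
  then show False using card n by linarith
qed

section \<open>Vanishing of the clearing counts\<close>

lemma dvd_if_returns_to_empty:
  assumes n: "n \<ge> 2" and "k > 0" and "(move n ^^ k) {} {}"
  shows "3 dvd n"
proof (rule ccontr)
  assume ndvd: "\<not> 3 dvd n"
  obtain c r :: "nat \<Rightarrow> nat" where pos: "\<exists>i<n. c i > 0 \<or> r i > 0"
    and eq: "\<And>x y. 1 + x + y = 0 \<Longrightarrow> (\<Sum>i<n. of_nat (c i) * x ^ i) * geom n y
      + (\<Sum>i<n. of_nat (r i) * y ^ i) * geom n x = 0"
    using moves_weight[OF assms(3)] assms(2) by (auto simp: weight_def)
  have c: "c i = c (n - 1)" if "i < n" for i
  proof -
    \<comment> \<open>At a zero x of \<open>geom n\<close> the row term drops out, and the factor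
      \<open>geom n (- 1 - x)\<close> of the column term is nonzero.\<close>
    have "(\<Sum>i<n. of_nat (c i) * x ^ i) = 0" if "geom n x = 0" for x :: complex
      using eq[of x "- 1 - x"] geom_no_common_zero[OF ndvd, of x "- 1 - x"] that by auto
    then show ?thesis
      using eq_const_if_zero_at_roots_of_unity[of n "\<lambda>i. of_nat (c i)" i] n that by simp
  qed
  have r: "r i = r (n - 1)" if "i < n" for i
  proof -
    have "(\<Sum>i<n. of_nat (r i) * y ^ i) = 0" if "geom n y = 0" for y :: complex
      using eq[of "- 1 - y" y] geom_no_common_zero[OF ndvd, of y "- 1 - y"] that by auto
    then show ?thesis
      using eq_const_if_zero_at_roots_of_unity[of n "\<lambda>i. of_nat (r i)" i] n that by simp
  qed
  define h :: complex where "h = - 1 / 2"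
  have "norm h = 1 / 2" by (simp add: h_def)
  then have h: "geom n h \<noteq> 0"
    using power_eq_1_iff[of h n] n geom_eq_0_iff[of n h] by auto
  have "(\<Sum>i<n. of_nat (c i) * h ^ i) = of_nat (c (n - 1)) * geom n h"
    "(\<Sum>i<n. of_nat (r i) * h ^ i) = of_nat (r (n - 1)) * geom n h"
    unfolding sum_distrib_left by (rule sum.cong, simp, metis c r lessThan_iff)+
  then have "of_nat (c (n - 1) + r (n - 1)) * (geom n h * geom n h) = 0"
    using eq[of h h] by (simp add: h_def algebra_simps)
  then have "of_nat (c (n - 1) + r (n - 1)) = (0 :: complex)"
    using h by (metis mult_eq_0_iff)
  then have "c (n - 1) = 0" "r (n - 1) = 0"
    by (simp_all only: of_nat_eq_0_iff add_is_0)
  with c r pos show False by (metis less_irrefl)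
qed

section \<open>Sufficiency\<close>

lemma place_trominoes:
  assumes "finite P" "\<And>i j. (i, j) \<in> P \<Longrightarrow> 1 \<le> i \<and> i \<le> n - 1 \<and> 1 \<le> j \<and> j \<le> n - 1"
    "\<And>p. p \<in> P \<Longrightarrow> case_prod tromino p \<inter> S = {}"
    "pairwise (\<lambda>p q. disjnt (case_prod tromino p) (case_prod tromino q)) P"
  shows "(move n)\<^sup>*\<^sup>* S (S \<union> \<Union> (case_prod tromino ` P))"
  using assms
proof (induction P rule: finite_induct)
  case (insert p P)
  obtain i j where p: "p = (i, j)" by fastforce
  let ?T = "S \<union> \<Union> (case_prod tromino ` P)"
  have "(move n)\<^sup>*\<^sup>* S ?T"
  proof (rule insert.IH)
    show "pairwise (\<lambda>p q. disjnt (case_prod tromino p) (case_prod tromino q)) P"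
      using insert.prems(3) pairwise_subset by blast
  qed (use insert.prems in blast)+
  moreover have "tromino i j \<inter> ?T = {}"
    using insert.prems(2)[of p] insert.prems(3) insert.hyps p
    by (fastforce simp: pairwise_insert disjnt_def)
  then have "move n ?T (?T \<union> tromino i j)"
    using insert.prems(1)[of i j] p by (intro place) auto
  moreover have "?T \<union> tromino i j = S \<union> \<Union> (case_prod tromino ` insert p P)"
    using p by auto
  ultimately show ?case by (metis rtranclp.rtrancl_into_rtrancl)
qed simp

lemma clear_columns:
  assumes "finite I" "\<And>i. i \<in> I \<Longrightarrow> 1 \<le> i \<and> i \<le> n \<and> column n i \<subseteq> S"
  shows "(move n)\<^sup>*\<^sup>* S (S - (\<Union>i\<in>I. column n i))"
  using assms
proof (induction I rule: finite_induct)
  case (insert i I)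
  let ?T = "S - (\<Union>i\<in>I. column n i)"
  have "column n i \<subseteq> ?T"
    using insert.hyps insert.prems[of i] by (auto simp: column_def)
  then have "move n ?T (?T - column n i)"
    using insert.prems[of i] by (intro clear_column) auto
  moreover have "?T - column n i = S - (\<Union>i\<in>insert i I. column n i)" by auto
  ultimately show ?case using insert by (metis insertI2 rtranclp.rtrancl_into_rtrancl)
qed simp

lemma clear_rows:
  assumes "finite J" "\<And>j. j \<in> J \<Longrightarrow> 1 \<le> j \<and> j \<le> n \<and> row n j \<subseteq> S"
  shows "(move n)\<^sup>*\<^sup>* S (S - (\<Union>j\<in>J. row n j))"
  using assms
proof (induction J rule: finite_induct)
  case (insert j J)
  let ?T = "S - (\<Union>j\<in>J. row n j)"
  have "row n j \<subseteq> ?T"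
    using insert.hyps insert.prems[of j] by (auto simp: row_def)
  then have "move n ?T (?T - row n j)"
    using insert.prems[of j] by (intro clear_row) auto
  moreover have "?T - row n j = S - (\<Union>j\<in>insert j J. row n j)" by auto
  ultimately show ?case using insert by (metis insertI2 rtranclp.rtrancl_into_rtrancl)
qed simp

section \<open>Positions periodic modulo 3\<close>

text \<open>The set \<open>Q\<close> is a position of the \<open>3 \<times> 3\<close> board; its coordinates are residues,
  so that the third row and column have index 0.\<close>

definition blocks :: "nat \<Rightarrow> cell set \<Rightarrow> cell set" where
  "blocks n Q = {(i, j). 1 \<le> i \<and> i \<le> n \<and> 1 \<le> j \<and> j \<le> n \<and> (i mod 3, j mod 3) \<in> Q}"

lemma finite_blocks: "finite (blocks n Q)"
  by (rule finite_subset[of _ "{1..n} \<times> {1..n}"]) (auto simp: blocks_def)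

lemma succ_le_if_mod_3:
  fixes i n :: nat
  assumes "3 dvd n" "i \<le> n" "i mod 3 \<noteq> 0"
  shows "Suc i \<le> n"
  using assms by presburger

text \<open>As \<open>a\<close> is 1 or 2, stepping back from residue a + 1 stays inside the same
  block, hence on the board.\<close>

lemma pred_if_mod_3:
  fixes i a :: nat
  assumes "i mod 3 = Suc a mod 3" "a \<in> {1, 2}" "1 \<le> i"
  obtains i' where "i = Suc i'" "i' mod 3 = a" "1 \<le> i'"
proof -
  obtain m where m: "i = Suc m" using assms(3) by (cases i) auto
  have "Suc m mod 3 = 2 \<and> a = 1 \<or> Suc m mod 3 = 0 \<and> a = 2"
    using assms(1,2) m by auto
  then have "m mod 3 = a" "1 \<le> m" by presburger+
  with m that show thesis by blast
qed

text \<open>Nonzero residues \<open>a\<close> and \<open>b\<close> keep each tromino inside the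
  block of its corner, and 3 dividing n keeps that block on the board. One tromino per block then
  realises a placement on the pattern \<open>Q\<close>.\<close>

lemma place_blocks:
  assumes dvd: "3 dvd n" and ab: "a \<in> {1, 2}" "b \<in> {1, 2}"
    and disj: "{(a, b), (Suc a mod 3, b), (a, Suc b mod 3)} \<inter> Q = {}"
  shows "(move n)\<^sup>*\<^sup>* (blocks n Q)
    (blocks n (Q \<union> {(a, b), (Suc a mod 3, b), (a, Suc b mod 3)}))"
proof -
  let ?P = "blocks n {(a, b)}"
  let ?N = "{(a, b), (Suc a mod 3, b), (a, Suc b mod 3)}"
  have sub: "case_prod tromino p \<subseteq> blocks n ?N" if "p \<in> ?P" for p
  proof -
    obtain i j where p: "p = (i, j)" by fastforce
    then have ij: "1 \<le> i" "i \<le> n" "1 \<le> j" "j \<le> n" "a = i mod 3" "b = j mod 3"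
      using that by (auto simp: blocks_def)
    then have "Suc i \<le> n" "Suc j \<le> n"
      using ab by (auto intro: succ_le_if_mod_3[OF dvd])
    then show ?thesis using ij by (simp add: p blocks_def tromino_def mod_Suc_eq)
  qed
  \<comment> \<open>The corner of the tromino covering a cell is the cell itself, its left neighbour
    or its lower neighbour, according to its residues.\<close>
  have "blocks n ?N \<subseteq> \<Union> (case_prod tromino ` ?P)"
  proof
    fix q assume q: "q \<in> blocks n ?N"
    obtain i j where [simp]: "q = (i, j)" by fastforce
    have ij: "1 \<le> i" "i \<le> n" "1 \<le> j" "j \<le> n" and
      "(i mod 3 = a \<and> j mod 3 = b) \<or> (i mod 3 = Suc a mod 3 \<and> j mod 3 = b)
        \<or> (i mod 3 = a \<and> j mod 3 = Suc b mod 3)" (is "?A \<or> ?B \<or> ?C")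
      using q by (auto simp: blocks_def)
    then consider ?A | ?B | ?C by blast
    then show "q \<in> \<Union> (case_prod tromino ` ?P)"
    proof cases
      case 1
      then show ?thesis using ij by (auto simp: blocks_def tromino_def)
    next
      case 2
      then obtain i' where "i = Suc i'" "i' mod 3 = a" "1 \<le> i'"
        using pred_if_mod_3[of i a] ij ab by metis
      then have "(i', j) \<in> ?P" "q \<in> case_prod tromino (i', j)"
        using ij 2 by (auto simp: blocks_def tromino_def)
      then show ?thesis by (rule UN_I)
    next
      case 3
      then obtain j' where "j = Suc j'" "j' mod 3 = b" "1 \<le> j'"
        using pred_if_mod_3[of j b] ij ab by metis
      then have "(i, j') \<in> ?P" "q \<in> case_prod tromino (i, j')"
        using ij 3 by (auto simp: blocks_def tromino_def)
      then show ?thesis by (rule UN_I)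
    qed
  qed
  then have "\<Union> (case_prod tromino ` ?P) = blocks n ?N"
    using sub by (intro antisym UN_least)
  moreover have "blocks n Q \<union> blocks n ?N = blocks n (Q \<union> ?N)"
    by (auto simp: blocks_def)
  moreover have "(move n)\<^sup>*\<^sup>* (blocks n Q) (blocks n Q \<union> \<Union> (case_prod tromino ` ?P))"
  proof (rule place_trominoes[OF finite_blocks])
    show "1 \<le> i \<and> i \<le> n - 1 \<and> 1 \<le> j \<and> j \<le> n - 1" if "(i, j) \<in> ?P" for i j
      using that ab succ_le_if_mod_3[OF dvd, of i] succ_le_if_mod_3[OF dvd, of j]
      by (auto simp: blocks_def)
    show "case_prod tromino p \<inter> blocks n Q = {}" if "p \<in> ?P" for p
      using sub[OF that] disj by (auto simp: blocks_def)
    \<comment> \<open>The three cells of a tromino have different residue pairs. As the corners are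
      congruent, a shared cell sits at the same place in both trominoes, so the corners
      agree.\<close>
    have "p = q" if "p \<in> ?P" "q \<in> ?P" "case_prod tromino p \<inter> case_prod tromino q \<noteq> {}" for p q
    proof -
      have ne: "Suc m mod 3 \<noteq> m mod 3" for m :: nat by presburger
      show ?thesis using that by (auto simp: blocks_def tromino_def ne ne[symmetric])
    qed
    then show "pairwise (\<lambda>p q. disjnt (case_prod tromino p) (case_prod tromino q)) ?P"
      unfolding pairwise_def disjnt_def by blast
  qed
  ultimately show ?thesis by simp
qed

lemma clear_column_blocks:
  assumes "{a} \<times> {0, 1, 2} \<subseteq> Q"
  shows "(move n)\<^sup>*\<^sup>* (blocks n Q) (blocks n (Q - {a} \<times> UNIV))"
proof -
  let ?I = "{i. 1 \<le> i \<and> i \<le> n \<and> i mod 3 = a}"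
  have "j mod 3 \<in> {0, 1, 2}" for j :: nat by (simp, presburger)
  \<comment> \<open>A full column of the pattern thus fills every column of the board with that
    residue.\<close>
  then have full: "(a, j mod 3) \<in> Q" for j using assms by blast
  have "(move n)\<^sup>*\<^sup>* (blocks n Q) (blocks n Q - (\<Union>i\<in>?I. column n i))"
  proof (rule clear_columns)
    show "1 \<le> i \<and> i \<le> n \<and> column n i \<subseteq> blocks n Q" if "i \<in> ?I" for i
      using that full by (auto simp: column_def blocks_def)
  qed simp
  moreover have "blocks n Q - (\<Union>i\<in>?I. column n i) = blocks n (Q - {a} \<times> UNIV)"
    by (auto simp: column_def blocks_def)
  ultimately show ?thesis by simp
qed

lemma clear_row_blocks:
  assumes "{0, 1, 2} \<times> {b} \<subseteq> Q"
  shows "(move n)\<^sup>*\<^sup>* (blocks n Q) (blocks n (Q - UNIV \<times> {b}))"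
proof -
  let ?J = "{j. 1 \<le> j \<and> j \<le> n \<and> j mod 3 = b}"
  have "i mod 3 \<in> {0, 1, 2}" for i :: nat by (simp, presburger)
  then have full: "(i mod 3, b) \<in> Q" for i using assms by blast
  have "(move n)\<^sup>*\<^sup>* (blocks n Q) (blocks n Q - (\<Union>j\<in>?J. row n j))"
  proof (rule clear_rows)
    show "1 \<le> j \<and> j \<le> n \<and> row n j \<subseteq> blocks n Q" if "j \<in> ?J" for j
      using that full by (auto simp: row_def blocks_def)
  qed simp
  moreover have "blocks n Q - (\<Union>j\<in>?J. row n j) = blocks n (Q - UNIV \<times> {b})"
    by (auto simp: row_def blocks_def)
  ultimately show ?thesis by simp
qed

section \<open>The sequence of moves on the pattern\<close>

lemma returns_to_empty_if_dvd:
  assumes n: "n \<ge> 2" and dvd: "3 dvd n"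
  shows "\<exists>k>0. (move n ^^ k) {} {}"
proof -
  let ?M = "(move n)\<^sup>*\<^sup>*"
  have "?M (blocks n {}) (blocks n {(1, 1), (2, 1), (1, 2)})"
    using place_blocks[OF dvd, of 1 1 "{}"] by (simp add: numeral_2_eq_2)
  then have first: "?M {} (blocks n {(1, 1), (2, 1), (1, 2)})"
    by (simp add: blocks_def)
  \<comment> \<open>A reflexive closure would permit zero moves; this stone shows that the board has
    changed, so at least one move was made.\<close>
  have "(1, 1) \<in> blocks n {(1, 1), (2, 1), (1, 2)}"
    using n by (auto simp: blocks_def)
  with first have nonempty: "(move n)\<^sup>+\<^sup>+ {} (blocks n {(1, 1), (2, 1), (1, 2)})"
    by (metis rtranclpD empty_iff)
  \<comment> \<open>The corner (2, 2) also reaches the third row and column, of index 0, and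
    completes column 2.\<close>
  have "?M (blocks n {(1, 1), (2, 1), (1, 2)})
    (blocks n {(1, 1), (2, 1), (1, 2), (2, 2), (0, 2), (2, 0)})"
    using place_blocks[OF dvd, of 2 2 "{(1, 1), (2, 1), (1, 2)}"] by (simp add: insert_commute)
  also have "?M \<dots> (blocks n {(1, 1), (1, 2), (0, 2)})"
    using clear_column_blocks[of 2 "{(1, 1), (2, 1), (1, 2), (2, 2), (0, 2), (2, 0)}" n]
    by (simp add: insert_Diff_if)
  \<comment> \<open>The remaining three stones are exactly what the tromino at (2, 1) lacks to fill
    rows 1 and 2.\<close>
  also have "?M \<dots> (blocks n {(1, 1), (1, 2), (0, 2), (2, 1), (0, 1), (2, 2)})"
    using place_blocks[OF dvd, of 2 1 "{(1, 1), (1, 2), (0, 2)}"]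
    by (simp add: insert_commute numeral_2_eq_2)
  also have "?M \<dots> (blocks n {(1, 2), (0, 2), (2, 2)})"
    using clear_row_blocks[of 1 "{(1, 1), (1, 2), (0, 2), (2, 1), (0, 1), (2, 2)}" n]
    by (simp add: insert_Diff_if)
  also have "?M \<dots> (blocks n {})"
    using clear_row_blocks[of 2 "{(1, 2), (0, 2), (2, 2)}" n]
    by (simp add: insert_Diff_if)
  also have "blocks n {} = {}"
    by (simp add: blocks_def)
  finally have "(move n)\<^sup>+\<^sup>+ {} {}"
    by (rule tranclp_rtranclp_tranclp[OF nonempty])
  then show ?thesis unfolding tranclp_power by blast
qed

theorem mainTheorem3:
  fixes n :: nat
  assumes "n \<ge> 2"
  shows "(\<exists>k::nat. k > 0 \<and> (move n ^^ k) {} {}) \<longleftrightarrow> 3 dvd n"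
  using assms dvd_if_returns_to_empty returns_to_empty_if_dvd by blast

end
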